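(* Let $A_1,\ldots,A_n:\mathcal H\rightrightarrows\mathcal H$ be maximally monotone operators on a real Hilbert space $\mathcal H$ with $\operatorname{zer}(\sum_{i=1}^nA_i)\neq\emptyset$, let $G=(\mathcal N,\mathcal E)$ be an algorithmic graph of order $n\ge 2$, $G'=(\mathcal N,\mathcal E')$ a connected spanning subgraph of $G$, and $Z\in\mathbb R^{n\times(n-1)}$ with $\operatorname{Lap}(G')=ZZ^*$. Let $\mathcal T=(\mathcal M+\mathcal A)^{-1}\mathcal M:\mathcal H^{2n-1}\to\mathcal H^{2n-1}$, with $\mathcal M,\mathcal A$ as defined in the context. Then, for any $\boldsymbol w\in\mathcal H^n$ and $\boldsymbol v\in\mathcal H^{n-1}$, $$\mathcal T\begin{bmatrix}\boldsymbol w\\\boldsymbol v\end{bmatrix}=\begin{bmatrix}\boldsymbol x\\\boldsymbol v+Z_\otimes^*(\boldsymbol w-2\boldsymbol x)\end{bmatrix},$$ where $\boldsymbol x\in\mathcal H^n$ is explicitly (recursively in $i$) computed as $$x_i=J_{\frac1{d_i}A_i}\bigg(\frac{d_i'}{d_i}w_i-\frac1{d_i}\sum_{(i,h)\in\mathcal E'}w_h-\frac1{d_i}\sum_{(h,i)\in\mathcal E'}w_h+\frac1{d_i}(Z_\otimes\boldsymbol v)_i+\frac2{d_i}\sum_{(h,i)\in\mathcal E}x_h\bigg),\quad i=1,\ldots,n.$$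
   Context: $\mathcal H^m$ carries the inner product $\langle\boldsymbol x,\boldsymbol y\rangle=\sum_i\langle x_i,y_i\rangle$. For set-valued $A$: $\operatorname{zer}A=\{x\mid0\in A(x)\}$ and $J_A=(\mathrm{Id}+A)^{-1}$ is the resolvent. Graphs: an algorithmic graph of order $n\ge2$ is a directed graph $G=(\mathcal N,\mathcal E)$ with $\mathcal N=\{1,\ldots,n\}$, $\mathcal E\subseteq\mathcal N\times\mathcal N$, $(i,j)\in\mathcal E\Rightarrow i<j$, and $G$ connected (ignoring edge directions). $G'=(\mathcal N,\mathcal E')$ is a spanning subgraph of $G$ if $\mathcal E'\subseteq\mathcal E$. The degree $d_i$ (resp. $d_i'$) is the number of edges of $G$ (resp. $G'$) entering or leaving node $i$. The Laplacian of a graph is the $n\times n$ matrix with the degrees of that graph on the diagonal, $-1$ in entry $(i,j)$ if $i,j$ are adjacent (i.e. $(i,j)$ or $(j,i)$ is an edge), and $0$ otherwise. Notation: for $K\in\mathbb R^{m\times p}$, $K_\otimes:\mathcal H^p\to\mathcal H^m$, $(K_\otimes\boldsymbol x)_i=\sum_jK_{i,j}x_j$; $Z_\otimes^*=(Z^* )_\otimes$. Operators: $\mathcal A_D(\boldsymbol x)=A_1(x_1)\times\cdots\times A_n(x_n)$ for $\boldsymbol x\in\mathcal H^n$. $P(G)\in\mathbb R^{n\times n}$ has entries $P(G)_{i,i}=d_i$, $P(G)_{i,j}=-2$ if $(j,i)\in\mathcal E$, and $0$ otherwise. On $\mathcal H^{2n-1}=\mathcal H^n\times\mathcal H^{n-1}$,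 $$\mathcal M=\begin{bmatrix}\operatorname{Lap}(G')&Z\\Z^*&I_{n-1}\end{bmatrix}_\otimes,\qquad \mathcal A=\begin{bmatrix}\mathcal A_D+P(G)_\otimes-\operatorname{Lap}(G')_\otimes&-Z_\otimes\\Z^*_\otimes&0\end{bmatrix},$$ and $(\mathcal M+\mathcal A)^{-1}$ is the inverse as a set-valued operator. *)

theory Defs
  imports
    "HOL-Analysis.Inner_Product"
    "HOL-Library.Set_Algebras"
    "Jordan_Normal_Form.Matrix"
    "Graph_Theory.Pair_Digraph"
    "Graph_Theory.Digraph_Component"
begin

text \<open>
  Conventions. A real Hilbert space is a type of class \<open>{real_inner, complete_space}\<close>.
  The space \<open>H^m\<close> is \<open>carrier_vec m\<close>, and an element \<open>(x, v)\<close> of the product of \<open>H^p\<close> and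
  \<open>H^q\<close> is the concatenation \<open>x @\<^sub>v v\<close> in \<open>H^(p+q)\<close>. Vectors and matrices are indexed from
  \<open>0\<close>, so the nodes \<open>1, ..., n\<close> of a graph of order \<open>n\<close> become \<open>0, ..., n - 1\<close>.
\<close>

type_synonym ('a, 'b) set_op = "'a \<Rightarrow> 'b set"

definition monotone_op :: "('a::real_inner, 'a) set_op \<Rightarrow> bool" where
  "monotone_op A \<longleftrightarrow> (\<forall>x y. \<forall>u\<in>A x. \<forall>v\<in>A y. 0 \<le> inner (x - y) (u - v))"

text \<open>For set-valued operators, \<open>A \<le> B\<close> is inclusion of graphs.\<close>

definition maximally_monotone :: "('a::real_inner, 'a) set_op \<Rightarrow> bool" where
  "maximally_monotone A \<longleftrightarrow>
     monotone_op A \<and> (\<forall>B. monotone_op B \<and> A \<le> B \<longrightarrow> B = A)"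

definition zer :: "('a, 'b::zero) set_op \<Rightarrow> 'a set" where
  "zer A = {x. 0 \<in> A x}"

text \<open>
  The space \<open>X\<close> on which the operator lives is explicit because \<open>H^m\<close> is a proper subset of
  its type.
\<close>

definition op_inverse :: "'a set \<Rightarrow> ('a, 'b) set_op \<Rightarrow> ('b, 'a) set_op" where
  "op_inverse X F = (\<lambda>u. {x \<in> X. u \<in> F x})"

text \<open>In \<open>{x} + A x\<close> the sum is the Minkowski sum.\<close>

definition resolvent :: "('a::plus, 'a) set_op \<Rightarrow> ('a, 'a) set_op" where
  "resolvent A = op_inverse UNIV (\<lambda>x. {x} + A x)"

definition scale_op :: "real \<Rightarrow> ('a, 'b::real_vector) set_op \<Rightarrow> ('a, 'b) set_op" where
  "scale_op c A = (\<lambda>x. (\<lambda>u. c *\<^sub>R u) ` A x)"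

definition algorithmic_graph :: "nat \<Rightarrow> nat pair_pre_digraph \<Rightarrow> bool" where
  "algorithmic_graph n G \<longleftrightarrow>
     2 \<le> n \<and> pverts G = {0..<n} \<and> parcs G \<subseteq> {0..<n} \<times> {0..<n} \<and>
     (\<forall>i j. (i, j) \<in> parcs G \<longrightarrow> i < j) \<and> Digraph_Component.connected G"

definition node_degree :: "nat pair_pre_digraph \<Rightarrow> nat \<Rightarrow> nat" where
  "node_degree G i = in_degree G i + out_degree G i"

definition Lap :: "nat \<Rightarrow> nat pair_pre_digraph \<Rightarrow> real mat" where
  "Lap n G = mat n n (\<lambda>(i, j).
     if i = j then real (node_degree G i)
     else if (i, j) \<in> parcs G \<or> (j, i) \<in> parcs G then - 1
     else 0)"

definition Pmat :: "nat \<Rightarrow> nat pair_pre_digraph \<Rightarrow> real mat" where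
  "Pmat n G = mat n n (\<lambda>(i, j).
     if i = j then real (node_degree G i)
     else if (j, i) \<in> parcs G then - 2
     else 0)"

definition mat_lift :: "real mat \<Rightarrow> 'a::real_vector vec \<Rightarrow> 'a vec" (infixr "\<otimes>\<^sub>H" 75) where
  "K \<otimes>\<^sub>H x = vec (dim_row K) (\<lambda>i. \<Sum>j<dim_col K. K $$ (i, j) *\<^sub>R x $ j)"

definition diag_op :: "nat \<Rightarrow> (nat \<Rightarrow> ('a, 'b) set_op) \<Rightarrow> ('a vec, 'b vec) set_op" where
  "diag_op n A = (\<lambda>x. {a \<in> carrier_vec n. \<forall>i<n. a $ i \<in> A i (x $ i)})"

definition calM :: "nat \<Rightarrow> nat pair_pre_digraph \<Rightarrow> real mat \<Rightarrow> 'a::real_vector vec \<Rightarrow> 'a vec" where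
  "calM n G' Z = (\<lambda>z.
     four_block_mat (Lap n G') Z
                    (transpose_mat Z) (1\<^sub>m (n - 1)) \<otimes>\<^sub>H z)"

definition calA ::
  "nat \<Rightarrow> nat pair_pre_digraph \<Rightarrow> nat pair_pre_digraph \<Rightarrow> real mat \<Rightarrow>
   (nat \<Rightarrow> ('a::real_vector, 'a) set_op) \<Rightarrow> ('a vec, 'a vec) set_op" where
  "calA n G G' Z A = (\<lambda>z.
     let x = vec_first z n; v = vec_last z (n - 1) in
     {(a + Pmat n G \<otimes>\<^sub>H x - Lap n G' \<otimes>\<^sub>H x - Z \<otimes>\<^sub>H v) @\<^sub>v (transpose_mat Z \<otimes>\<^sub>H x)
        | a. a \<in> diag_op n A x})"

definition calT ::
  "nat \<Rightarrow> nat pair_pre_digraph \<Rightarrow> nat pair_pre_digraph \<Rightarrow> real mat \<Rightarrow>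
   (nat \<Rightarrow> ('a::real_vector, 'a) set_op) \<Rightarrow> ('a vec, 'a vec) set_op" where
  "calT n G G' Z A = (\<lambda>z.
     op_inverse (carrier_vec (2 * n - 1)) (\<lambda>y. {calM n G' Z y} + calA n G G' Z A y) (calM n G' Z z))"

end

theory Submission
  imports Defs "HOL-Analysis.Convex"
begin

text \<open>
  The inclusion defining the operator can be solved because \<open>\<M>\<close> was chosen to cancel the
  coupling in \<open>\<A>\<close>. For a candidate value \<open>(x, y)\<close>, the first block row of \<open>(\<M> + \<A>) (x, y)\<close>
  has neither the Laplacian nor \<open>Z y\<close> left in it: it is \<open>\<A>\<^sub>D x + P(G) x\<close>. The second block row is
  \<open>2 Z\<^sup>* x + y\<close>, which determines \<open>y\<close> from \<open>x\<close>; this is lemma \<open>calT_append\<close>. Since every edge goes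
  from a smaller to a larger node, \<open>P(G)\<close> is lower triangular with the degrees on its diagonal,
  so row \<open>i\<close> of the first block involves only \<open>x\<^sub>i\<close> and earlier components. All degrees are positive
  by connectedness, and division by \<open>d\<^sub>i\<close> turns the row into the evaluation of the resolvent of
  \<open>(1/d\<^sub>i) A\<^sub>i\<close> at a point known from the earlier components. The components are thus
  determined one after the other (lemma \<open>unique_triangular_system\<close>).

  This needs each resolvent to be single-valued and defined everywhere, which is Minty's theorem
  (lemma \<open>resolvent_single_valued\<close>). Surjectivity is proved with the Fitzpatrick function
  \<open>\<phi>(x, x') = sup {\<langle>x, b\<rangle> + \<langle>y, x'\<rangle> - \<langle>y, b\<rangle> | b \<in> A y}\<close> of \<open>A\<close>. It is convex and lower semicontinuous,
  it equals \<open>\<langle>y, b\<rangle>\<close> on the graph of \<open>A\<close>, and maximality gives \<open>\<phi>(x, x') \<ge> \<langle>x, x'\<rangle>\<close> everywhere.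
  If \<open>(p, q)\<close> minimises \<open>\<phi> + \<parallel>\<cdot>\<parallel>\<^sup>2 / 2\<close>, the optimality condition makes \<open>(-q, -p)\<close> monotonically
  related to the whole graph, so it belongs to the graph, and then it forces \<open>p + q = 0\<close>.
  Hence \<open>- p \<in> A p\<close>.
\<close>

section \<open>Proximal points of closed convex epigraphs\<close>

text \<open>
  When \<open>E\<close> is the epigraph of \<open>\<phi>\<close>, this is the minimiser of \<open>\<phi> + \<parallel>\<cdot>\<parallel>\<^sup>2 / 2\<close> together with its
  optimality condition, that \<open>- z0\<close> is a subgradient of \<open>\<phi>\<close> at \<open>z0\<close>. Working with the epigraph
  avoids extended-real values and turns lower semicontinuity into closedness. A minimising
  sequence is Cauchy by strong convexity, so completeness replaces weak compactness.
\<close>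

lemma epigraph_proximal_point:
  fixes E :: "('k::{real_inner, complete_space} \<times> real) set"
  assumes closed: "closed E" and convex: "convex E" and nonempty: "E \<noteq> {}"
    and bounded_below: "\<And>z t. (z, t) \<in> E \<Longrightarrow> l \<le> t + (norm z)\<^sup>2 / 2"
  obtains z0 t0 where "(z0, t0) \<in> E"
    and "\<And>z t. (z, t) \<in> E \<Longrightarrow> t0 \<le> t + inner z0 (z - z0)"
proof -
  define g :: "'k \<times> real \<Rightarrow> real" where "g e = snd e + (norm (fst e))\<^sup>2 / 2" for e
  define m where "m = Inf (g ` E)"
  have bdd: "bdd_below (g ` E)"
    using bounded_below by (auto intro!: bdd_belowI2[where m = l] simp: g_def)
  have m_le: "m \<le> g e" if "e \<in> E" for e
    unfolding m_def using bdd that by (rule cINF_lower)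
  have "\<exists>e\<in>E. g e < m + 1 / real (Suc k)" for k
  proof -
    have "Inf (g ` E) < m + 1 / real (Suc k)" by (simp add: m_def)
    then show ?thesis using nonempty bdd by (subst (asm) cINF_less_iff) auto
  qed
  then obtain e where e_in: "\<And>k. e k \<in> E" and e_less: "\<And>k. g (e k) < m + 1 / real (Suc k)"
    by metis
  \<comment> \<open>The parallelogram law: the midpoint of two near-minimisers would beat \<open>m\<close>
      unless they are close.\<close>
  have gap: "(norm (fst a - fst b))\<^sup>2 \<le> 4 * (g a - m) + 4 * (g b - m)"
    if "a \<in> E" "b \<in> E" for a b
  proof -
    have "(1/2) *\<^sub>R a + (1/2) *\<^sub>R b \<in> E"
      using that by (intro convexD[OF convex]) auto
    then have "m \<le> g ((1/2) *\<^sub>R a + (1/2) *\<^sub>R b)" by (rule m_le)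
    also have "\<dots> = g a / 2 + g b / 2 - (norm (fst a - fst b))\<^sup>2 / 8"
      by (simp add: g_def power2_norm_eq_inner inner_simps inner_commute[of "fst b" "fst a"] field_simps)
    finally show ?thesis by simp
  qed
  have "Cauchy (\<lambda>k. fst (e k))"
  proof (rule metric_CauchyI)
    fix \<epsilon> :: real assume "0 < \<epsilon>"
    then obtain N where N: "8 / \<epsilon>\<^sup>2 < real N" using reals_Archimedean2 by blast
    have "dist (fst (e p)) (fst (e q)) < \<epsilon>" if "p \<ge> N" "q \<ge> N" for p q
    proof -
      have small: "8 * (g (e k) - m) < \<epsilon>\<^sup>2" if "k \<ge> N" for k
      proof -
        have "8 / \<epsilon>\<^sup>2 < real (Suc k)" using N that by simp
        then have "8 * (1 / real (Suc k)) < \<epsilon>\<^sup>2" using \<open>0 < \<epsilon>\<close> by (simp add: field_simps)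
        then show ?thesis using e_less[of k] by argo
      qed
      have "(norm (fst (e p) - fst (e q)))\<^sup>2 < \<epsilon>\<^sup>2"
        using gap[OF e_in e_in, of p q] small[OF that(1)] small[OF that(2)] by argo
      then show ?thesis using \<open>0 < \<epsilon>\<close> by (simp add: dist_norm power_less_imp_less_base)
    qed
    then show "\<exists>M. \<forall>p\<ge>M. \<forall>q\<ge>M. dist (fst (e p)) (fst (e q)) < \<epsilon>" by blast
  qed
  then obtain z0 where z0: "(\<lambda>k. fst (e k)) \<longlonglongrightarrow> z0"
    using Cauchy_convergent_iff convergent_def by blast
  define t0 where "t0 = m - (norm z0)\<^sup>2 / 2"
  have "(\<lambda>k. m + 1 / real (Suc k)) \<longlonglongrightarrow> m"
    using tendsto_add[OF tendsto_const LIMSEQ_Suc[OF lim_1_over_n], of m] by simp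
  then have "(\<lambda>k. g (e k)) \<longlonglongrightarrow> m"
    by (rule real_tendsto_sandwich[where f = "\<lambda>_. m", rotated -1])
      (intro always_eventually allI tendsto_const m_le e_in less_imp_le[OF e_less])+
  then have "(\<lambda>k. g (e k) - (norm (fst (e k)))\<^sup>2 / 2) \<longlonglongrightarrow> t0"
    unfolding t0_def by (intro tendsto_intros z0) auto
  then have "(\<lambda>k. snd (e k)) \<longlonglongrightarrow> t0" by (simp add: g_def)
  with z0 have "(\<lambda>k. (fst (e k), snd (e k))) \<longlonglongrightarrow> (z0, t0)" by (rule tendsto_Pair)
  then have in_E: "(z0, t0) \<in> E"
    using closed e_in by (auto intro: closed_sequentially)
  moreover have "t0 \<le> t + inner z0 (z - z0)" if zt: "(z, t) \<in> E" for z t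
  proof (rule ccontr)
    define a where "a = t0 - t - inner z0 (z - z0)"
    define c where "c = (norm (z - z0))\<^sup>2 / 2"
    assume "\<not> ?thesis"
    then have a: "0 < a" by (simp add: a_def)
    have c: "0 \<le> c" by (simp add: c_def)
    \<comment> \<open>Moving from \<open>z0\<close> towards \<open>z\<close> by \<open>s\<close> changes \<open>g\<close> by \<open>s * (s * c - a)\<close>.\<close>
    define s where "s = min 1 (a / (c + 1))"
    have s: "0 < s" "s \<le> 1" using a c by (auto simp: s_def)
    have "s * c < a"
    proof -
      have "s * c \<le> a / (c + 1) * c" using c by (intro mult_right_mono) (auto simp: s_def)
      also have "\<dots> < a" using a c by (simp add: field_simps)
      finally show ?thesis .
    qed
    have "(1 - s) *\<^sub>R (z0, t0) + s *\<^sub>R (z, t) \<in> E"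
      using s in_E zt by (intro convexD[OF convex]) auto
    then have "m \<le> g ((1 - s) *\<^sub>R (z0, t0) + s *\<^sub>R (z, t))" by (rule m_le)
    also have "(1 - s) *\<^sub>R (z0, t0) + s *\<^sub>R (z, t) = (z0 + s *\<^sub>R (z - z0), t0 + s * (t - t0))"
      by (simp add: algebra_simps)
    also have "g \<dots> = m + s * (s * c - a)"
      by (simp add: g_def t0_def a_def c_def power2_norm_eq_inner inner_simps inner_commute[of z z0] field_simps)
    finally have "0 \<le> s * (s * c - a)" by simp
    with s \<open>s * c < a\<close> show False by (simp add: zero_le_mult_iff)
  qed
  ultimately show thesis using that by blast
qed

section \<open>Minty's theorem\<close>

lemma maximally_monotoneD:
  assumes "maximally_monotone A" "u \<in> A x" "v \<in> A y"
  shows "0 \<le> inner (x - y) (u - v)"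
  using assms by (auto simp: maximally_monotone_def monotone_op_def)

text \<open>
  Otherwise the point \<open>(x, u)\<close> could be added to the graph, against maximality.
\<close>

lemma maximally_monotone_memI:
  assumes A: "maximally_monotone A"
    and related: "\<And>y b. b \<in> A y \<Longrightarrow> 0 \<le> inner (x - y) (u - b)"
  shows "u \<in> A x"
proof -
  define B where "B = A(x := insert u (A x))"
  have "inner (y - x) (b - u) = inner (x - y) (u - b)" for y b
    by (simp add: algebra_simps)
  then have "monotone_op B"
    using A related unfolding monotone_op_def B_def maximally_monotone_def
    by (auto split: if_splits)
  moreover have "A \<le> B" by (auto simp: B_def le_fun_def)
  ultimately have "B = A" using A by (auto simp: maximally_monotone_def)
  then show ?thesis by (metis B_def fun_upd_same insertI1)
qed

text \<open>
  Covers both the scaling by \<open>1 / d\<^sub>i\<close> and the translation that reduces the solution of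
  \<open>u \<in> x + A x\<close> to the case \<open>u = 0\<close>.
\<close>

lemma maximally_monotone_affine_image:
  assumes A: "maximally_monotone A" and c: "0 < c"
  shows "maximally_monotone (\<lambda>x. (\<lambda>a. c *\<^sub>R a + d) ` A x)"
  unfolding maximally_monotone_def
proof (intro conjI allI impI)
  let ?B = "\<lambda>x. (\<lambda>a. c *\<^sub>R a + d) ` A x"
  have "0 \<le> inner (x - y) (c *\<^sub>R (u - v))" if "u \<in> A x" "v \<in> A y" for x y u v
    using maximally_monotoneD[OF A that] c by simp
  then show "monotone_op ?B"
    by (auto simp: monotone_op_def scaleR_diff_right)
  fix C assume C: "monotone_op C \<and> ?B \<le> C"
  have "C x \<subseteq> ?B x" for x
  proof
    fix u assume u: "u \<in> C x"
    have "(1 / c) *\<^sub>R (u - d) \<in> A x"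
    proof (rule maximally_monotone_memI[OF A])
      fix y b assume "b \<in> A y"
      then have "c *\<^sub>R b + d \<in> C y" using C by (auto simp: le_fun_def)
      with u C have "0 \<le> inner (x - y) (u - (c *\<^sub>R b + d))" by (auto simp: monotone_op_def)
      also have "u - (c *\<^sub>R b + d) = c *\<^sub>R ((1 / c) *\<^sub>R (u - d) - b)"
        using c by (simp add: scaleR_diff_right)
      finally show "0 \<le> inner (x - y) ((1 / c) *\<^sub>R (u - d) - b)"
        using c by (simp add: zero_le_mult_iff)
    qed
    then show "u \<in> ?B x" using c by (intro image_eqI[where x = "(1 / c) *\<^sub>R (u - d)"]) auto
  qed
  with C show "C = ?B" by (intro antisym) (auto simp: le_fun_def)
qed

lemma maximally_monotone_scale:
  "maximally_monotone A \<Longrightarrow> 0 < c \<Longrightarrow> maximally_monotone (scale_op c A)"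
  using maximally_monotone_affine_image[of A c 0] by (simp add: scale_op_def)

text \<open>
  The surjectivity half of Minty's theorem, at the single point \<open>0\<close>. The set \<open>E\<close> in the proof
  is the epigraph of the Fitzpatrick function of \<open>A\<close>.
\<close>

lemma maximally_monotone_neg_id_meets_graph:
  fixes A :: "('a::{real_inner, complete_space}, 'a) set_op"
  assumes A: "maximally_monotone A"
  obtains x where "- x \<in> A x"
proof -
  define E :: "(('a \<times> 'a) \<times> real) set" where
    "E = (\<Inter>(y, b) \<in> {(y, b). b \<in> A y}.
            {e. inner (b, y) (fst e) - snd e \<le> inner y b})"
  have E_iff: "((x, x'), t) \<in> E \<longleftrightarrow>
      (\<forall>y. \<forall>b\<in>A y. inner b x + inner y x' - t \<le> inner y b)" for x x' t
    by (auto simp: E_def)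
  have halfspace: "{e. inner (b, y) (fst e) - snd e \<le> inner y b} =
      {e. inner ((b, y), - 1 :: real) e \<le> inner y b}" for y b :: 'a
    by (auto simp: inner_prod_def)
  have "closed {e. inner c e \<le> d}" for c :: "('a \<times> 'a) \<times> real" and d
    by (intro closed_Collect_le bounded_linear.continuous_on[OF bounded_linear_inner_right] continuous_on_const continuous_on_id)
  then have "closed E"
    unfolding E_def halfspace by (auto intro!: closed_INT)
  have "convex E"
    unfolding E_def halfspace by (auto intro!: convex_INT convex_halfspace_le)
  \<comment> \<open>A point where the Fitzpatrick function lies below \<open>\<langle>x, x'\<rangle>\<close> is monotonically related to the
      graph, hence on it, where the function is at least \<open>\<langle>x, x'\<rangle>\<close>: a contradiction.\<close>
  have above_diagonal: "inner x x' \<le> t" if "((x, x'), t) \<in> E" for x x' t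
  proof (rule ccontr)
    assume less: "\<not> ?thesis"
    have "x' \<in> A x"
    proof (rule maximally_monotone_memI[OF A])
      fix y b assume "b \<in> A y"
      then have "inner b x + inner y x' - t \<le> inner y b" using that by (simp add: E_iff)
      with less show "0 \<le> inner (x - y) (x' - b)"
        by (simp add: algebra_simps inner_commute)
    qed
    then have "inner x' x + inner x x' - t \<le> inner x x'" using that by (auto simp: E_iff)
    with less show False by (simp add: inner_commute)
  qed
  have graph_in_E: "((y, b), inner y b) \<in> E" if "b \<in> A y" for y b
    unfolding E_iff
  proof (intro allI ballI)
    fix y' b' assume "b' \<in> A y'"
    from maximally_monotoneD[OF A that this]
    show "inner b' y + inner y' b - inner y b \<le> inner y' b'"
      by (simp add: algebra_simps inner_commute)
  qed
  have "E \<noteq> {}"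
  proof -
    have "\<exists>y b. b \<in> A y"
      using maximally_monotone_memI[OF A, of 0 0] by blast
    then show ?thesis using graph_in_E by blast
  qed
  have bounded: "0 \<le> t + (norm z)\<^sup>2 / 2" if "(z, t) \<in> E" for z t
  proof -
    obtain x x' where z: "z = (x, x')" by (cases z)
    have "0 \<le> inner (x + x') (x + x')" by simp
    then show ?thesis
      using above_diagonal[OF that[unfolded z]]
      by (simp add: z power2_norm_eq_inner inner_simps inner_commute[of x' x] field_simps)
  qed
  obtain z0 t0 where z0: "(z0, t0) \<in> E"
    and prox: "\<And>z t. (z, t) \<in> E \<Longrightarrow> t0 \<le> t + inner z0 (z - z0)"
    using epigraph_proximal_point[OF \<open>closed E\<close> \<open>convex E\<close> \<open>E \<noteq> {}\<close> bounded] by blast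
  obtain p q where pq: "z0 = (p, q)" by (cases z0)
  \<comment> \<open>The optimality condition at a point of the graph, completed to an inner product with
      \<open>\<langle>p, q\<rangle> \<le> t0\<close>.\<close>
  have gap: "inner (p + q) (p + q) \<le> inner (- q - y) (- p - b)" if "b \<in> A y" for y b
    using prox[OF graph_in_E[OF that]] above_diagonal[OF z0[unfolded pq]]
    by (simp add: pq algebra_simps inner_commute)
  then have "- p \<in> A (- q)"
    by (intro maximally_monotone_memI[OF A]) (meson inner_ge_zero order_trans)
  \<comment> \<open>At \<open>(- q, - p)\<close> itself the right-hand side of \<open>gap\<close> vanishes.\<close>
  moreover from gap[OF this] have "p + q = 0"
    by (metis diff_self inner_ge_zero inner_eq_zero_iff inner_zero_left order_antisym)
  then have "q = - p" by (simp add: add_eq_0_iff)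
  ultimately have "- p \<in> A p" by simp
  then show thesis by (rule that)
qed

lemma resolvent_mem_iff:
  fixes A :: "('a::ab_group_add, 'a) set_op"
  shows "x \<in> resolvent A u \<longleftrightarrow> u - x \<in> A x"
proof -
  have "u \<in> {x} + A x \<longleftrightarrow> (\<exists>a\<in>A x. u = x + a)" by (simp add: set_plus_def)
  also have "\<dots> \<longleftrightarrow> u - x \<in> A x" by (metis add_diff_cancel_left' diff_add_cancel add.commute)
  finally show ?thesis by (simp add: resolvent_def op_inverse_def)
qed

lemma resolvent_scale_mem_iff:
  fixes A :: "('a::real_vector, 'a) set_op"
  assumes d: "0 < d"
  shows "p \<in> resolvent (scale_op (1 / d) A) ((1 / d) *\<^sub>R r) \<longleftrightarrow> r - d *\<^sub>R p \<in> A p"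
proof -
  have "(1 / d) *\<^sub>R r - p = (1 / d) *\<^sub>R a \<longleftrightarrow> r - d *\<^sub>R p = a" for a
  proof -
    have "(1 / d) *\<^sub>R r - p = (1 / d) *\<^sub>R (r - d *\<^sub>R p)"
      using d by (simp add: scaleR_diff_right)
    then show ?thesis using d by (simp only: scaleR_cancel_left) simp
  qed
  then show ?thesis by (auto simp: resolvent_mem_iff scale_op_def image_iff)
qed

text \<open>
  Existence is \<open>maximally_monotone_neg_id_meets_graph\<close> for the translate \<open>A - u\<close>; uniqueness holds
  because two values \<open>x\<close>, \<open>y\<close> give \<open>0 \<le> - \<parallel>y - x\<parallel>\<^sup>2\<close> by monotonicity.
\<close>

lemma resolvent_single_valued:
  fixes A :: "('a::{real_inner, complete_space}, 'a) set_op"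
  assumes A: "maximally_monotone A"
  shows "\<exists>x. resolvent A u = {x}"
proof -
  have "maximally_monotone (\<lambda>x. (\<lambda>a. 1 *\<^sub>R a + - u) ` A x)"
    using A by (rule maximally_monotone_affine_image) simp
  then obtain x where "- x \<in> (\<lambda>a. 1 *\<^sub>R a + - u) ` A x"
    by (rule maximally_monotone_neg_id_meets_graph)
  then obtain a where "a \<in> A x" "u - x = a" by (auto simp: algebra_simps)
  then have x: "x \<in> resolvent A u" by (simp add: resolvent_mem_iff)
  moreover have "y = x" if "y \<in> resolvent A u" for y
  proof -
    have "0 \<le> inner (y - x) ((u - y) - (u - x))"
      using x that unfolding resolvent_mem_iff by (intro maximally_monotoneD[OF A])
    also have "\<dots> = - inner (y - x) (y - x)" by (simp add: algebra_simps)
    finally show ?thesis by (metis inner_ge_zero neg_0_le_iff_le antisym inner_eq_zero_iff eq_iff_diff_eq_0)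
  qed
  ultimately show ?thesis by blast
qed



section \<open>Degrees in a connected graph\<close>

text \<open>
  The degrees are divisors in the recursion. A walk in the underlying symmetric graph from \<open>i\<close>
  to some other node has to leave \<open>i\<close> along an edge of \<open>G\<close>, in one direction or the other.
\<close>

lemma connected_node_degree_pos:
  assumes conn: "Digraph_Component.connected (with_proj G)"
    and arcs: "finite (parcs G)"
    and i: "i \<in> pverts G" and j: "j \<in> pverts G" "i \<noteq> j"
  shows "0 < node_degree G i"
proof -
  have "reachable (with_proj (mk_symmetric (with_proj G))) i j"
    using conn i j by (simp add: connected_def strongly_connected_def)
  then have "(i, j) \<in> (parcs (mk_symmetric (with_proj G)))\<^sup>*"
    using reachable_rtranclI by fastforce
  then obtain k where "(i, k) \<in> parcs (mk_symmetric (with_proj G))"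
    using \<open>i \<noteq> j\<close> by (metis converse_rtranclE)
  then obtain e where "e \<in> parcs G" "fst e = i \<or> snd e = i"
    by (auto simp: parcs_mk_symmetric)
  then have "e \<in> in_arcs (with_proj G) i \<or> e \<in> out_arcs (with_proj G) i" by auto
  moreover have "finite (in_arcs (with_proj G) i)" "finite (out_arcs (with_proj G) i)"
    using arcs by (auto simp: in_arcs_def out_arcs_def)
  ultimately show ?thesis
    by (auto simp: node_degree_def in_degree_def out_degree_def card_gt_0_iff)
qed

section \<open>Real matrices acting on vectors over a Hilbert space\<close>

lemma dim_mat_lift [simp]: "dim_vec (K \<otimes>\<^sub>H x) = dim_row K"
  by (simp add: mat_lift_def)

lemma sum_lessThan_add:
  fixes f :: "nat \<Rightarrow> 'a::comm_monoid_add"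
  shows "(\<Sum>k<p + q. f k) = (\<Sum>k<p. f k) + (\<Sum>k<q. f (p + k))"
  by (induction q) (simp_all add: add.assoc)

lemma mat_lift_four_block:
  assumes "A \<in> carrier_mat m p" "B \<in> carrier_mat m q" "C \<in> carrier_mat r p" "D \<in> carrier_mat r q"
    and "x \<in> carrier_vec p" "y \<in> carrier_vec q"
  shows "four_block_mat A B C D \<otimes>\<^sub>H (x @\<^sub>v y) = (A \<otimes>\<^sub>H x + B \<otimes>\<^sub>H y) @\<^sub>v (C \<otimes>\<^sub>H x + D \<otimes>\<^sub>H y)"
  using assms by (intro eq_vecI) (auto simp: mat_lift_def sum_lessThan_add)

lemma mat_lift_one: "y \<in> carrier_vec q \<Longrightarrow> 1\<^sub>m q \<otimes>\<^sub>H y = y"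
  by (intro eq_vecI) (auto simp: mat_lift_def if_distrib[of "\<lambda>c. c *\<^sub>R _"] sum.delta' cong: if_cong)

lemma mat_lift_diff:
  assumes "K \<in> carrier_mat m p" "x \<in> carrier_vec p" "y \<in> carrier_vec p"
  shows "K \<otimes>\<^sub>H (x - y) = K \<otimes>\<^sub>H x - K \<otimes>\<^sub>H y"
  using assms by (intro eq_vecI) (auto simp: mat_lift_def scaleR_diff_right sum_subtractf)

lemma mat_lift_double:
  assumes "K \<in> carrier_mat m p" "x \<in> carrier_vec p"
  shows "K \<otimes>\<^sub>H map_vec (\<lambda>y. 2 *\<^sub>R y) x = K \<otimes>\<^sub>H x + K \<otimes>\<^sub>H x"
  using assms by (intro eq_vecI) (auto simp: mat_lift_def sum.distrib[symmetric] scaleR_2 scaleR_add_right)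

section \<open>Rows of the graph matrices\<close>

lemma sum_diagonal_support:
  fixes f :: "nat \<Rightarrow> 'a::comm_monoid_add"
  assumes "i < n" "S \<subseteq> {..<n}" "i \<notin> S" "\<And>j. j < n \<Longrightarrow> j \<noteq> i \<Longrightarrow> j \<notin> S \<Longrightarrow> f j = 0"
  shows "(\<Sum>j<n. f j) = f i + (\<Sum>j\<in>S. f j)"
proof -
  have "(\<Sum>j<n. f j) = (\<Sum>j\<in>insert i S. f j)"
    using assms by (intro sum.mono_neutral_right) auto
  also have "\<dots> = f i + (\<Sum>j\<in>S. f j)"
    using assms finite_subset[OF assms(2)] by simp
  finally show ?thesis .
qed

lemma Pmat_mat_lift_index:
  assumes arcs: "\<And>i j. (i, j) \<in> parcs G \<Longrightarrow> i < j \<and> j < n" and i: "i < n"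
  shows "(Pmat n G \<otimes>\<^sub>H x) $ i =
    real (node_degree G i) *\<^sub>R x $ i - 2 *\<^sub>R (\<Sum>h | (h, i) \<in> parcs G. x $ h)"
proof -
  let ?S = "{h. (h, i) \<in> parcs G}"
  have "(Pmat n G \<otimes>\<^sub>H x) $ i = (\<Sum>j<n. Pmat n G $$ (i, j) *\<^sub>R x $ j)"
    using i by (simp add: mat_lift_def Pmat_def)
  also have "\<dots> = Pmat n G $$ (i, i) *\<^sub>R x $ i + (\<Sum>j\<in>?S. Pmat n G $$ (i, j) *\<^sub>R x $ j)"
    using i by (intro sum_diagonal_support) (auto simp: Pmat_def dest: arcs)
  also have "(\<Sum>j\<in>?S. Pmat n G $$ (i, j) *\<^sub>R x $ j) = (\<Sum>j\<in>?S. - 2 *\<^sub>R x $ j)"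
  proof (intro sum.cong refl)
    fix j assume "j \<in> ?S"
    with arcs[of j i] i show "Pmat n G $$ (i, j) *\<^sub>R x $ j = - 2 *\<^sub>R x $ j"
      by (auto simp: Pmat_def)
  qed
  also have "\<dots> = - 2 *\<^sub>R (\<Sum>j\<in>?S. x $ j)" by (rule scaleR_sum_right[symmetric])
  finally show ?thesis using i by (simp add: Pmat_def)
qed

lemma Lap_mat_lift_index:
  assumes arcs: "\<And>i j. (i, j) \<in> parcs G \<Longrightarrow> i < j \<and> j < n" and i: "i < n"
  shows "(Lap n G \<otimes>\<^sub>H x) $ i = real (node_degree G i) *\<^sub>R x $ i
    - (\<Sum>h | (i, h) \<in> parcs G. x $ h) - (\<Sum>h | (h, i) \<in> parcs G. x $ h)"
proof -
  let ?O = "{h. (i, h) \<in> parcs G}" and ?I = "{h. (h, i) \<in> parcs G}"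
  have sub: "?O \<union> ?I \<subseteq> {..<n}" using i by (auto dest: arcs)
  have fin: "finite ?O" "finite ?I" using finite_subset[OF sub] by auto
  have "(Lap n G \<otimes>\<^sub>H x) $ i = (\<Sum>j<n. Lap n G $$ (i, j) *\<^sub>R x $ j)"
    using i by (simp add: mat_lift_def Lap_def)
  also have "\<dots> = Lap n G $$ (i, i) *\<^sub>R x $ i + (\<Sum>j\<in>?O \<union> ?I. Lap n G $$ (i, j) *\<^sub>R x $ j)"
    using i sub by (intro sum_diagonal_support) (auto simp: Lap_def dest: arcs)
  also have "(\<Sum>j\<in>?O \<union> ?I. Lap n G $$ (i, j) *\<^sub>R x $ j) = (\<Sum>j\<in>?O \<union> ?I. - x $ j)"
  proof (intro sum.cong refl)
    fix j assume "j \<in> ?O \<union> ?I"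
    with arcs[of i j] arcs[of j i] i show "Lap n G $$ (i, j) *\<^sub>R x $ j = - x $ j"
      by (auto simp: Lap_def)
  qed
  also have "\<dots> = - (\<Sum>j\<in>?O. x $ j) - (\<Sum>j\<in>?I. x $ j)"
  proof -
    have "?O \<inter> ?I = {}" using less_asym arcs by blast
    then show ?thesis using fin by (simp add: sum.union_disjoint sum_negf)
  qed
  finally show ?thesis using i by (simp add: Lap_def)
qed

section \<open>Elimination of the coupling\<close>

lemma calM_append:
  assumes "Z \<in> carrier_mat n (n - 1)" "x \<in> carrier_vec n" "y \<in> carrier_vec (n - 1)"
  shows "calM n G' Z (x @\<^sub>v y) =
    (Lap n G' \<otimes>\<^sub>H x + Z \<otimes>\<^sub>H y) @\<^sub>v (transpose_mat Z \<otimes>\<^sub>H x + y)"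
proof -
  have "Lap n G' \<in> carrier_mat n n" by (simp add: Lap_def)
  then show ?thesis
    using assms by (simp add: calM_def mat_lift_four_block mat_lift_one)
qed

lemma vec_first_append: "x \<in> carrier_vec p \<Longrightarrow> vec_first (x @\<^sub>v y) p = x"
  by (intro eq_vecI) (auto simp: vec_first_def)

lemma vec_last_append: "y \<in> carrier_vec q \<Longrightarrow> vec_last (x @\<^sub>v y) q = y"
  by (intro eq_vecI) (auto simp: vec_last_def)

text \<open>
  The cancellation for which the preconditioner is designed: the Laplacian and \<open>Z\<close> cancel in the
  first block, so what remains of it does not involve \<open>y\<close>.
\<close>

lemma calM_plus_calA_append:
  fixes x y :: "'a::real_vector vec"
  assumes Z: "Z \<in> carrier_mat n (n - 1)" and x: "x \<in> carrier_vec n" and y: "y \<in> carrier_vec (n - 1)"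
  shows "{calM n G' Z (x @\<^sub>v y)} + calA n G G' Z A (x @\<^sub>v y) =
    {(a + Pmat n G \<otimes>\<^sub>H x) @\<^sub>v (transpose_mat Z \<otimes>\<^sub>H x + transpose_mat Z \<otimes>\<^sub>H x + y) | a.
      a \<in> diag_op n A x}"
proof -
  have sum: "calM n G' Z (x @\<^sub>v y)
      + ((a + Pmat n G \<otimes>\<^sub>H x - Lap n G' \<otimes>\<^sub>H x - Z \<otimes>\<^sub>H y) @\<^sub>v (transpose_mat Z \<otimes>\<^sub>H x)) =
      (a + Pmat n G \<otimes>\<^sub>H x) @\<^sub>v (transpose_mat Z \<otimes>\<^sub>H x + transpose_mat Z \<otimes>\<^sub>H x + y)"
    if "a \<in> carrier_vec n" for a
    unfolding calM_append[OF assms] using assms that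
    by (intro eq_vecI) (auto simp: Pmat_def Lap_def)
  have "{calM n G' Z (x @\<^sub>v y)} + calA n G G' Z A (x @\<^sub>v y) =
      (\<lambda>a. calM n G' Z (x @\<^sub>v y)
        + ((a + Pmat n G \<otimes>\<^sub>H x - Lap n G' \<otimes>\<^sub>H x - Z \<otimes>\<^sub>H y) @\<^sub>v (transpose_mat Z \<otimes>\<^sub>H x)))
      ` diag_op n A x"
    using x y by (auto simp: calA_def set_plus_def vec_first_append vec_last_append)
  also have "\<dots> = (\<lambda>a. (a + Pmat n G \<otimes>\<^sub>H x)
        @\<^sub>v (transpose_mat Z \<otimes>\<^sub>H x + transpose_mat Z \<otimes>\<^sub>H x + y)) ` diag_op n A x"
    by (intro image_cong refl sum) (simp add: diag_op_def)
  finally show ?thesis by auto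
qed

text \<open>
  Block elimination: the second block row is solved for \<open>y\<close>, and the first one is read
  componentwise. The value of the operator is left as a set, since solvability of the rows
  is a separate matter.
\<close>

lemma calT_append:
  assumes n: "1 \<le> n" and Z: "Z \<in> carrier_mat n (n - 1)"
    and w: "w \<in> carrier_vec n" and v: "v \<in> carrier_vec (n - 1)"
  shows "calT n G G' Z A (w @\<^sub>v v) =
    {x @\<^sub>v (v + transpose_mat Z \<otimes>\<^sub>H (w - map_vec (\<lambda>y. 2 *\<^sub>R y) x)) | x.
      x \<in> carrier_vec n \<and>
      (\<forall>i<n. (Lap n G' \<otimes>\<^sub>H w) $ i + (Z \<otimes>\<^sub>H v) $ i - (Pmat n G \<otimes>\<^sub>H x) $ i \<in> A i (x $ i))}"
    (is "_ = {?y x | x. ?P x}")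
proof -
  have dim: "2 * n - 1 = n + (n - 1)" using n by simp
  have mem: "x @\<^sub>v y \<in> calT n G G' Z A (w @\<^sub>v v) \<longleftrightarrow>
      ?P x \<and> y = v + transpose_mat Z \<otimes>\<^sub>H (w - map_vec (\<lambda>y. 2 *\<^sub>R y) x)"
    if x: "x \<in> carrier_vec n" and y: "y \<in> carrier_vec (n - 1)" for x y
  proof -
    let ?b = "Lap n G' \<otimes>\<^sub>H w + Z \<otimes>\<^sub>H v"
    let ?Zt = "transpose_mat Z"
    have "x @\<^sub>v y \<in> calT n G G' Z A (w @\<^sub>v v) \<longleftrightarrow>
      (\<exists>a\<in>diag_op n A x. ?b @\<^sub>v (?Zt \<otimes>\<^sub>H w + v) =
        (a + Pmat n G \<otimes>\<^sub>H x) @\<^sub>v (?Zt \<otimes>\<^sub>H x + ?Zt \<otimes>\<^sub>H x + y))"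
      using append_carrier_vec[OF x y]
      unfolding calT_def op_inverse_def dim mem_Collect_eq
        calM_plus_calA_append[OF Z x y] calM_append[OF Z w v] by blast
    also have "\<dots> \<longleftrightarrow> (\<exists>a\<in>diag_op n A x. ?b = a + Pmat n G \<otimes>\<^sub>H x) \<and>
        ?Zt \<otimes>\<^sub>H w + v = ?Zt \<otimes>\<^sub>H x + ?Zt \<otimes>\<^sub>H x + y"
    proof -
      have "?b @\<^sub>v (?Zt \<otimes>\<^sub>H w + v) = (a + Pmat n G \<otimes>\<^sub>H x) @\<^sub>v (?Zt \<otimes>\<^sub>H x + ?Zt \<otimes>\<^sub>H x + y) \<longleftrightarrow>
          ?b = a + Pmat n G \<otimes>\<^sub>H x \<and> ?Zt \<otimes>\<^sub>H w + v = ?Zt \<otimes>\<^sub>H x + ?Zt \<otimes>\<^sub>H x + y"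
        if "a \<in> diag_op n A x" for a
        using that Z
        by (intro append_vec_eq[of _ n]) (auto simp: diag_op_def Lap_def Pmat_def intro!: carrier_vecI)
      then show ?thesis by blast
    qed
    also have "(\<exists>a\<in>diag_op n A x. ?b = a + Pmat n G \<otimes>\<^sub>H x) \<longleftrightarrow>
        ?b - Pmat n G \<otimes>\<^sub>H x \<in> diag_op n A x"
    proof
      assume "\<exists>a\<in>diag_op n A x. ?b = a + Pmat n G \<otimes>\<^sub>H x"
      then obtain a where a: "a \<in> diag_op n A x" "?b = a + Pmat n G \<otimes>\<^sub>H x" by blast
      moreover have "a + Pmat n G \<otimes>\<^sub>H x - Pmat n G \<otimes>\<^sub>H x = a"
        using a(1) by (intro eq_vecI) (auto simp: diag_op_def Pmat_def)
      ultimately show "?b - Pmat n G \<otimes>\<^sub>H x \<in> diag_op n A x" by simp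
    next
      have "?b = (?b - Pmat n G \<otimes>\<^sub>H x) + Pmat n G \<otimes>\<^sub>H x"
        using Z by (intro eq_vecI) (auto simp: Pmat_def Lap_def)
      then show "?b - Pmat n G \<otimes>\<^sub>H x \<in> diag_op n A x \<Longrightarrow>
          \<exists>a\<in>diag_op n A x. ?b = a + Pmat n G \<otimes>\<^sub>H x" by blast
    qed
    also have "\<dots> \<longleftrightarrow> ?P x"
    proof -
      have "?b - Pmat n G \<otimes>\<^sub>H x \<in> carrier_vec n"
        by (intro carrier_vecI) (simp add: Pmat_def)
      moreover have "(?b - Pmat n G \<otimes>\<^sub>H x) $ i =
          (Lap n G' \<otimes>\<^sub>H w) $ i + (Z \<otimes>\<^sub>H v) $ i - (Pmat n G \<otimes>\<^sub>H x) $ i" if "i < n" for i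
        using Z that by (simp add: Pmat_def)
      ultimately show ?thesis using x by (simp add: diag_op_def)
    qed
    also have "?Zt \<otimes>\<^sub>H w + v = ?Zt \<otimes>\<^sub>H x + ?Zt \<otimes>\<^sub>H x + y \<longleftrightarrow>
        y = v + ?Zt \<otimes>\<^sub>H (w - map_vec (\<lambda>y. 2 *\<^sub>R y) x)"
    proof -
      have "?Zt \<otimes>\<^sub>H (w - map_vec (\<lambda>y. 2 *\<^sub>R y) x) = ?Zt \<otimes>\<^sub>H w - (?Zt \<otimes>\<^sub>H x + ?Zt \<otimes>\<^sub>H x)"
        using Z w x by (simp add: mat_lift_diff[of _ "n - 1" n] mat_lift_double[of _ "n - 1" n])
      moreover have "(?Zt \<otimes>\<^sub>H w + v) $ i = (?Zt \<otimes>\<^sub>H x + ?Zt \<otimes>\<^sub>H x + y) $ i \<longleftrightarrow>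
          y $ i = (v + (?Zt \<otimes>\<^sub>H w - (?Zt \<otimes>\<^sub>H x + ?Zt \<otimes>\<^sub>H x))) $ i" if "i < n - 1" for i
        using Z v y that by (simp add: algebra_simps) metis
      ultimately show ?thesis using Z v y by (simp add: vec_eq_iff)
    qed
    finally show ?thesis .
  qed
  show ?thesis (is "?L = ?R")
  proof (intro equalityI subsetI)
    fix z assume z: "z \<in> ?L"
    then have "z \<in> carrier_vec (n + (n - 1))" by (simp only: calT_def op_inverse_def dim mem_Collect_eq)
    then have "z = vec_first z n @\<^sub>v vec_last z (n - 1)" by simp
    with z mem[of "vec_first z n" "vec_last z (n - 1)"] show "z \<in> ?R" by auto
  next
    fix z assume "z \<in> ?R"
    then obtain x where x: "?P x" "z = ?y x" by blast
    have "v + transpose_mat Z \<otimes>\<^sub>H (w - map_vec (\<lambda>y. 2 *\<^sub>R y) x) \<in> carrier_vec (n - 1)"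
      using Z v by (auto intro!: carrier_vecI)
    with x mem show "z \<in> ?L" by auto
  qed
qed

section \<open>Forward substitution\<close>

text \<open>
  Row \<open>i\<close> of the system is a relation \<open>Q i s p\<close> between the history \<open>s\<close> and the value \<open>p\<close> of the
  component \<open>i\<close>. Forward substitution yields a solution by well-founded recursion, and two
  solutions agree component by component.
\<close>

lemma unique_triangular_system:
  assumes solve: "\<And>i s. i < n \<Longrightarrow> \<exists>!p. Q i s p"
    and triangular: "\<And>i s s' p. i < n \<Longrightarrow> (\<And>j. j < i \<Longrightarrow> s j = s' j) \<Longrightarrow> Q i s p = Q i s' p"
  obtains x where "x \<in> carrier_vec n"
    and "\<And>y. y \<in> carrier_vec n \<Longrightarrow> (\<forall>i<n. Q i (($) y) (y $ i)) \<longleftrightarrow> y = x"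
proof -
  have "\<exists>f. \<forall>i. i < n \<longrightarrow> Q i f (f i)"
  proof (rule dependent_wf_choice[OF wf_less_than])
    show "(i < n \<longrightarrow> Q i f r) = (i < n \<longrightarrow> Q i g r)"
      if "\<And>z. (z, i) \<in> less_than \<Longrightarrow> f z = g z" for f g i r
      using triangular[of i f g r] that by auto
    show "\<exists>r. i < n \<longrightarrow> Q i f r" for i f
      using solve[of i f] by blast
  qed
  then obtain f where f: "\<And>i. i < n \<Longrightarrow> Q i f (f i)" by blast
  define x where "x = vec n f"
  have x: "Q i (($) x) (x $ i)" if "i < n" for i
    using f[OF that] triangular[OF that, of "($) x" f] that by (simp add: x_def)
  show thesis
  proof (rule that)
    show "x \<in> carrier_vec n" by (simp add: x_def)
    fix y :: "'a vec" assume y: "y \<in> carrier_vec n"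
    have "y $ i = x $ i" if all: "\<forall>i<n. Q i (($) y) (y $ i)" and "i < n" for i
      using \<open>i < n\<close>
    proof (induction i rule: less_induct)
      case (less i)
      then have "Q i (($) x) (y $ i)"
        using all triangular[OF less.prems, of "($) y" "($) x" "y $ i"] by simp
      then show ?case using x[OF less.prems] solve[OF less.prems] by blast
    qed
    then show "(\<forall>i<n. Q i (($) y) (y $ i)) \<longleftrightarrow> y = x"
      using x y by (auto simp: x_def intro!: eq_vecI)
  qed
qed

section \<open>The preconditioned operator\<close>

theorem proposition3p4:
  fixes A :: "nat \<Rightarrow> 'a::{real_inner, complete_space} \<Rightarrow> 'a set"
    and n :: nat and G G' :: "nat pair_pre_digraph" and Z :: "real mat"
    and w v :: "'a vec"
  assumes "\<And>i. i < n \<Longrightarrow> maximally_monotone (A i)"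
    and "zer (\<lambda>x. \<Sum>i<n. A i x) \<noteq> {}"
    and "algorithmic_graph n G"
    and "spanning G' G"
    and "Digraph_Component.connected G'"
    and "Z \<in> carrier_mat n (n - 1)"
    and "Lap n G' = Z * transpose_mat Z"
    and "w \<in> carrier_vec n"
    and "v \<in> carrier_vec (n - 1)"
  shows "\<exists>x \<in> carrier_vec n.
    (\<forall>i<n. let d = real (node_degree G i); d' = real (node_degree G' i) in
       resolvent (scale_op (1 / d) (A i))
         ((d' / d) *\<^sub>R w $ i
          - (1 / d) *\<^sub>R (\<Sum>h | (i, h) \<in> parcs G'. w $ h)
          - (1 / d) *\<^sub>R (\<Sum>h | (h, i) \<in> parcs G'. w $ h)
          + (1 / d) *\<^sub>R (Z \<otimes>\<^sub>H v) $ i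
          + (2 / d) *\<^sub>R (\<Sum>h | (h, i) \<in> parcs G. x $ h))
       = {x $ i}) \<and>
    calT n G G' Z A (w @\<^sub>v v)
      = {x @\<^sub>v (v + transpose_mat Z \<otimes>\<^sub>H (w - map_vec (\<lambda>y. 2 *\<^sub>R y) x))}"
proof -
  have arcs: "i < j \<and> j < n" if "(i, j) \<in> parcs G" for i j
    using assms(3) that by (auto simp: algorithmic_graph_def)
  have n: "2 \<le> n" and conn: "Digraph_Component.connected G" and verts: "pverts G = {0..<n}"
    and "parcs G \<subseteq> {0..<n} \<times> {0..<n}"
    using assms(3) by (auto simp: algorithmic_graph_def)
  then have finite_arcs: "finite (parcs G)" by (meson finite_SigmaI finite_atLeastLessThan finite_subset)
  have arcs': "i < j \<and> j < n" if "(i, j) \<in> parcs G'" for i j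
    using assms(4) that arcs by (auto simp: spanning_def subgraph_def)
  let ?d = "\<lambda>i. real (node_degree G i)" and ?d' = "\<lambda>i. real (node_degree G' i)"
  have deg: "0 < ?d i" if "i < n" for i
  proof -
    have "\<exists>j<n. i \<noteq> j"
      using n by (intro exI[of _ "if i = 0 then 1 else 0"]) auto
    then show ?thesis
      using connected_node_degree_pos[OF conn finite_arcs, of i] that by (auto simp: verts)
  qed
  \<comment> \<open>\<open>r i x\<close> is \<open>d\<^sub>i\<close> times the point at which the resolvent is evaluated.\<close>
  define b where "b i = (Lap n G' \<otimes>\<^sub>H w) $ i + (Z \<otimes>\<^sub>H v) $ i" for i
  define r where "r i s = b i + 2 *\<^sub>R (\<Sum>h | (h, i) \<in> parcs G. s h)" for i and s :: "nat \<Rightarrow> 'a"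
  have argument: "(?d' i / ?d i) *\<^sub>R w $ i
      - (1 / ?d i) *\<^sub>R (\<Sum>h | (i, h) \<in> parcs G'. w $ h)
      - (1 / ?d i) *\<^sub>R (\<Sum>h | (h, i) \<in> parcs G'. w $ h)
      + (1 / ?d i) *\<^sub>R (Z \<otimes>\<^sub>H v) $ i
      + (2 / ?d i) *\<^sub>R (\<Sum>h | (h, i) \<in> parcs G. s h) = (1 / ?d i) *\<^sub>R r i s"
    if "i < n" for i and s :: "nat \<Rightarrow> 'a"
    using that by (simp add: r_def b_def Lap_mat_lift_index[OF arcs'] scaleR_add_right scaleR_diff_right)
  define Q where "Q i s p \<longleftrightarrow> p \<in> resolvent (scale_op (1 / ?d i) (A i)) ((1 / ?d i) *\<^sub>R r i s)" for i s p
  have single: "\<exists>p. resolvent (scale_op (1 / ?d i) (A i)) u = {p}" if "i < n" for i u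
    using that assms(1) deg by (intro resolvent_single_valued maximally_monotone_scale) auto
  obtain x where x: "x \<in> carrier_vec n"
    and unique: "\<And>y. y \<in> carrier_vec n \<Longrightarrow> (\<forall>i<n. Q i (($) y) (y $ i)) \<longleftrightarrow> y = x"
  proof (rule unique_triangular_system[of n Q])
    show "\<exists>!p. Q i s p" if "i < n" for i s
      using single[OF that, of "(1 / ?d i) *\<^sub>R r i s"] by (auto simp: Q_def)
    show "Q i s p = Q i s' p" if "i < n" "\<And>j. j < i \<Longrightarrow> s j = s' j" for i s s' p
    proof -
      have "(\<Sum>h | (h, i) \<in> parcs G. s h) = (\<Sum>h | (h, i) \<in> parcs G. s' h)"
        using that arcs by (intro sum.cong) auto
      then show ?thesis by (simp add: Q_def r_def)
    qed
  qed blast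
  have "Q i (($) y) (y $ i) \<longleftrightarrow>
      (Lap n G' \<otimes>\<^sub>H w) $ i + (Z \<otimes>\<^sub>H v) $ i - (Pmat n G \<otimes>\<^sub>H y) $ i \<in> A i (y $ i)"
    if "i < n" for i y
    unfolding Q_def resolvent_scale_mem_iff[OF deg[OF that]]
    by (simp add: r_def b_def Pmat_mat_lift_index[OF arcs that] algebra_simps)
  then have "calT n G G' Z A (w @\<^sub>v v) =
      {y @\<^sub>v (v + transpose_mat Z \<otimes>\<^sub>H (w - map_vec (\<lambda>y. 2 *\<^sub>R y) y)) | y.
        y \<in> carrier_vec n \<and> (\<forall>i<n. Q i (($) y) (y $ i))}"
    using n by (simp add: calT_append[OF _ assms(6,8,9)])
  also have "\<dots> = {x @\<^sub>v (v + transpose_mat Z \<otimes>\<^sub>H (w - map_vec (\<lambda>y. 2 *\<^sub>R y) x))}"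
    using x unique by auto
  finally have T: "calT n G G' Z A (w @\<^sub>v v) =
      {x @\<^sub>v (v + transpose_mat Z \<otimes>\<^sub>H (w - map_vec (\<lambda>y. 2 *\<^sub>R y) x))}" .
  have "resolvent (scale_op (1 / ?d i) (A i)) ((1 / ?d i) *\<^sub>R r i (($) x)) = {x $ i}" if "i < n" for i
    using single[OF that, of "(1 / ?d i) *\<^sub>R r i (($) x)"] unique[OF x] that by (auto simp: Q_def)
  with T x argument show ?thesis by (intro bexI[of _ x]) (auto simp: Let_def)
qed

end
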